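(* Let $G=(V,E)$ be a connected finite graph with symmetric positive edge weights $w_{xy}=w_{yx}>0$ ($xy\in E$) and positive measure $\mu:V\to(0,+\infty)$, and let $p>2$. For $m>0$, let $u_m:V\to\mathbb{R}$ denote a solution, with some $\lambda_m\in\mathbb{R}$, of $$-\Delta u_m+\lambda_m u_m=u_m^{p-1}\ \text{ in } V,\qquad u_m>0\ \text{ in } V,\qquad \int_V u_m^2\,d\mu=m.$$ (i) Along any sequence $m\to 0^+$, up to a subsequence, there is a function $v:V\to\mathbb{R}$ such that $u_m=\sqrt{m}\,v+o(\sqrt{m})$ on $V$, where either $v\equiv |V|^{-1/2}$ on $V$, or $v$ satisfies $$-\Delta v=\lambda_0 v\ \text{ in } V,\qquad v>0\ \text{ in } V,\qquad \int_V v^2\,d\mu=1$$ for some constant $\lambda_0>0$. (ii) Along any sequence $m\to+\infty$, up to a subsequence, there is a function $w:V\to\mathbb{R}$ such that $u_m=\sqrt{m}\,(w+o_m(1))$ on $V$, where $o_m(1)\to 0$ as $m\to+\infty$, and $w$ satisfies $$w^{p-1}-\|w\|_p^p\,w=0\quad\text{on } V.$$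
   Context: For $u:V\to\mathbb{R}$ the $\mu$-Laplacian is $\Delta u(x)=\frac{1}{\mu(x)}\sum_{y\sim x}w_{xy}(u(y)-u(x))$, where $y\sim x$ means $xy\in E$. The integral is $\int_V u\,d\mu=\sum_{x\in V}\mu(x)u(x)$, $|V|=\int_V 1\,d\mu$ is the volume of $V$, and $\|w\|_p=(\int_V|w|^p\,d\mu)^{1/p}$. The real number $\lambda_m$ is a Lagrange multiplier which depends on $u_m$ and is not prescribed. Since $V$ is finite, the $o(\cdot)$ terms are understood pointwise (equivalently uniformly) on $V$. In (ii), $w$ is a pointwise limit of positive functions, so $w^{p-1}$ is the usual power of a nonnegative number. *)

theory Defs
  imports
    "Graph_Theory.Graph_Theory"
    "HOL-Analysis.Analysis"
    "HOL-Library.Landau_Symbols"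
begin

text \<open>
  A simple undirected graph is a \<^locale>\<open>pair_graph\<close>: its arcs form a finite, symmetric and
  irreflexive relation on the vertices, and both orientations of an edge are arcs. Functions on
  the vertex set are total functions on the vertex type; only their values on \<open>pverts G\<close> matter.
\<close>

locale weighted_finite_graph = pair_graph G
  for G :: "'a pair_pre_digraph" +
  fixes wt :: "'a \<Rightarrow> 'a \<Rightarrow> real"
    and \<mu> :: "'a \<Rightarrow> real"
  assumes connected_graph: "Digraph_Component.connected (with_proj G)"
    and wt_sym: "\<And>x y. (x, y) \<in> parcs G \<Longrightarrow> wt x y = wt y x"
    and wt_pos: "\<And>x y. (x, y) \<in> parcs G \<Longrightarrow> 0 < wt x y"
    and measure_pos: "\<And>x. x \<in> pverts G \<Longrightarrow> 0 < \<mu> x"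

definition graph_laplacian ::
  "'a pair_pre_digraph \<Rightarrow> ('a \<Rightarrow> 'a \<Rightarrow> real) \<Rightarrow> ('a \<Rightarrow> real) \<Rightarrow> ('a \<Rightarrow> real) \<Rightarrow> 'a \<Rightarrow> real" where
  "graph_laplacian G wt \<mu> u x =
     1 / \<mu> x * (\<Sum>y \<in> {y. (x, y) \<in> parcs G}. wt x y * (u y - u x))"

definition graph_integral :: "'a pair_pre_digraph \<Rightarrow> ('a \<Rightarrow> real) \<Rightarrow> ('a \<Rightarrow> real) \<Rightarrow> real" where
  "graph_integral G \<mu> u = (\<Sum>x \<in> pverts G. \<mu> x * u x)"

definition graph_volume :: "'a pair_pre_digraph \<Rightarrow> ('a \<Rightarrow> real) \<Rightarrow> real" where
  "graph_volume G \<mu> = graph_integral G \<mu> (\<lambda>x. 1)"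

definition graph_Lp_norm ::
  "'a pair_pre_digraph \<Rightarrow> ('a \<Rightarrow> real) \<Rightarrow> real \<Rightarrow> ('a \<Rightarrow> real) \<Rightarrow> real" where
  "graph_Lp_norm G \<mu> p u = graph_integral G \<mu> (\<lambda>x. \<bar>u x\<bar> powr p) powr (1 / p)"

definition normalized_solution ::
  "'a pair_pre_digraph \<Rightarrow> ('a \<Rightarrow> 'a \<Rightarrow> real) \<Rightarrow> ('a \<Rightarrow> real) \<Rightarrow> real \<Rightarrow> real \<Rightarrow> real \<Rightarrow> ('a \<Rightarrow> real) \<Rightarrow> bool"
  where
  "normalized_solution G wt \<mu> p m l u \<longleftrightarrow>
     (\<forall>x \<in> pverts G. - graph_laplacian G wt \<mu> u x + l * u x = u x powr (p - 1)) \<and>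
     (\<forall>x \<in> pverts G. 0 < u x) \<and>
     graph_integral G \<mu> (\<lambda>x. (u x)\<^sup>2) = m"

end

theory Submission
  imports Defs "HOL-Real_Asymp.Real_Asymp"
begin

text \<open>
  Rescale to unit mass: \<open>v = u\<^sub>m / \<surd>m\<close> is positive, satisfies \<open>\<integral> v\<^sup>2 d\<mu> = 1\<close>, and solves
  \<open>- \<Delta> v + \<lambda> v = c v\<^bsup>p-1\<^esup>\<close> with \<open>c = m\<^bsup>(p-2)/2\<^esup>\<close>. As \<open>p > 2\<close>, the coefficient \<open>c\<close> tends to \<open>0\<close> or to
  \<open>\<infinity>\<close> together with \<open>m\<close>. On a finite vertex set the functions of unit mass form a compact set, so
  along a subsequence \<open>v\<close> converges to some \<open>w \<ge> 0\<close> of unit mass, and the whole proof consists in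
  passing to the limit in the equation.

  What makes this possible is that the multiplier is determined by \<open>v\<close>: the integral of a Laplacian
  vanishes (Green's formula), so integrating the equation gives
  \<open>\<lambda> = c \<integral> v\<^bsup>p-1\<^esup> d\<mu> / \<integral> v d\<mu>\<close>, a multiplier rule proved below as \<open>multiplier_eq\<close>. The quotient
  converges, because \<open>\<integral> w d\<mu> > 0\<close>.

  If \<open>c \<rightarrow> 0\<close>, then \<open>\<lambda> \<rightarrow> 0\<close> and the limit is harmonic; on a connected graph it is therefore
  constant, and unit mass fixes the constant as \<open>|V|\<^bsup>-1/2\<^esup>\<close>. So for small mass it is always the first
  of the two alternatives that occurs.

  If \<open>c \<rightarrow> \<infinity>\<close>, divide by \<open>c\<close>: the Laplacian disappears, and \<open>w\<^bsup>p-1\<^esup> = \<Lambda> w\<close> where \<open>\<Lambda>\<close> is the limit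
  of \<open>\<lambda> / c\<close>. Testing against \<open>w\<close> and using unit mass identifies \<open>\<Lambda>\<close> as \<open>\<parallel>w\<parallel>\<^sub>p\<^sup>p\<close>.
\<close>

section \<open>Calculus on a weighted graph\<close>

context weighted_finite_graph
begin

text \<open>
  Every edge is counted in both directions; averaging the two contributions moves the difference
  from \<open>u\<close> to \<open>\<phi>\<close> and produces the factor \<open>1/2\<close>.
\<close>

lemma green_formula:
  "graph_integral G \<mu> (\<lambda>x. \<phi> x * graph_laplacian G wt \<mu> u x) =
     - (1/2) * (\<Sum>(x, y) \<in> parcs G. wt x y * ((\<phi> y - \<phi> x) * (u y - u x)))"
proof -
  have nbr_finite: "finite {y. (x, y) \<in> parcs G}" for x
    by (rule finite_subset[OF _ pair_finite_verts]) (auto dest: in_arcsD2)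
  have parcs_Sigma: "parcs G = Sigma (pverts G) (\<lambda>x. {y. (x, y) \<in> parcs G})"
    by (auto dest: in_arcsD1)
  have "graph_integral G \<mu> (\<lambda>x. \<phi> x * graph_laplacian G wt \<mu> u x) =
      (\<Sum>x \<in> pverts G. \<Sum>y \<in> {y. (x, y) \<in> parcs G}. wt x y * (\<phi> x * (u y - u x)))"
    unfolding graph_integral_def graph_laplacian_def
  proof (rule sum.cong[OF refl])
    fix x assume "x \<in> pverts G"
    then have "\<mu> x \<noteq> 0" using measure_pos by fastforce
    then show "\<mu> x * (\<phi> x * (1 / \<mu> x * (\<Sum>y | (x, y) \<in> parcs G. wt x y * (u y - u x)))) =
        (\<Sum>y | (x, y) \<in> parcs G. wt x y * (\<phi> x * (u y - u x)))"
      by (simp add: sum_distrib_left mult_ac)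
  qed
  also have "\<dots> = (\<Sum>(x, y) \<in> parcs G. wt x y * (\<phi> x * (u y - u x)))"
    by (subst sum.Sigma)
      (auto simp: pair_finite_verts nbr_finite parcs_Sigma[symmetric])
  finally have I: "graph_integral G \<mu> (\<lambda>x. \<phi> x * graph_laplacian G wt \<mu> u x) =
      (\<Sum>(x, y) \<in> parcs G. wt x y * (\<phi> x * (u y - u x)))" .
  have "(\<Sum>(x, y) \<in> parcs G. wt x y * (\<phi> x * (u y - u x))) =
      (\<Sum>(x, y) \<in> parcs G. wt x y * (\<phi> y * (u x - u y)))"
    by (rule sum.reindex_bij_witness[where i = prod.swap and j = prod.swap])
      (auto intro: arcs_symmetric, metis wt_sym)
  with I have "2 * graph_integral G \<mu> (\<lambda>x. \<phi> x * graph_laplacian G wt \<mu> u x) =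
      (\<Sum>(x, y) \<in> parcs G. wt x y * (\<phi> x * (u y - u x))) +
      (\<Sum>(x, y) \<in> parcs G. wt x y * (\<phi> y * (u x - u y)))"
    by simp
  also have "\<dots> = (\<Sum>(x, y) \<in> parcs G. - (wt x y * ((\<phi> y - \<phi> x) * (u y - u x))))"
    unfolding sum.distrib[symmetric] by (rule sum.cong) (auto simp: algebra_simps)
  also have "\<dots> = - (\<Sum>(x, y) \<in> parcs G. wt x y * ((\<phi> y - \<phi> x) * (u y - u x)))"
    by (simp add: sum_negf case_prod_unfold)
  finally show ?thesis by simp
qed

corollary integral_laplacian: "graph_integral G \<mu> (graph_laplacian G wt \<mu> u) = 0"
  using green_formula[of "\<lambda>_. 1" u] by simp

text \<open>
  Testing \<open>\<Delta> v = 0\<close> against \<open>v\<close> shows that the Dirichlet energy vanishes, so \<open>v\<close> does not change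
  across any edge; connectedness does the rest.
\<close>

lemma harmonic_imp_constant:
  assumes harmonic: "\<And>x. x \<in> pverts G \<Longrightarrow> graph_laplacian G wt \<mu> v x = 0"
    and "x \<in> pverts G" "y \<in> pverts G"
  shows "v x = v y"
proof -
  have "(\<Sum>(x, y) \<in> parcs G. wt x y * ((v y - v x) * (v y - v x))) = 0"
    using green_formula[of v v] by (simp add: graph_integral_def harmonic)
  then have "\<forall>a \<in> parcs G. (case a of (x, y) \<Rightarrow> wt x y * ((v y - v x) * (v y - v x))) = 0"
    by (subst (asm) sum_nonneg_eq_0_iff) (auto simp: pair_finite_arcs dest!: wt_pos)
  then have edge: "v a = v b" if "(a, b) \<in> parcs G" for a b
    using that wt_pos by fastforce
  have "strongly_connected (with_proj G)"
    using pair_sym_arcs connected_graph by (rule symmetric_connected_imp_strongly_connected)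
  then have "x \<rightarrow>\<^sup>*\<^bsub>with_proj G\<^esub> y"
    using assms(2,3) by (simp add: strongly_connected_def)
  then show ?thesis
    by (induction rule: reachable_induct) (auto dest: edge)
qed

section \<open>Positive functions of unit mass\<close>

lemma tendsto_graph_integral:
  assumes "\<And>x. x \<in> pverts G \<Longrightarrow> ((\<lambda>k. f k x) \<longlongrightarrow> g x) F"
  shows "((\<lambda>k. graph_integral G \<mu> (f k)) \<longlongrightarrow> graph_integral G \<mu> g) F"
  unfolding graph_integral_def by (intro tendsto_intros assms)

lemma tendsto_graph_laplacian:
  assumes "\<And>x. x \<in> pverts G \<Longrightarrow> ((\<lambda>k. f k x) \<longlongrightarrow> g x) F" and "x \<in> pverts G"
  shows "((\<lambda>k. graph_laplacian G wt \<mu> (f k) x) \<longlongrightarrow> graph_laplacian G wt \<mu> g x) F"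
  unfolding graph_laplacian_def
  by (intro tendsto_intros assms) (auto dest: in_arcsD2)

lemma graph_integral_pos:
  assumes "\<And>x. x \<in> pverts G \<Longrightarrow> 0 \<le> f x" and "z \<in> pverts G" "0 < f z"
  shows "0 < graph_integral G \<mu> f"
  unfolding graph_integral_def
  using assms measure_pos by (intro sum_pos2[of _ z]) (auto simp: pair_finite_verts less_imp_le)

lemma unit_mass_imp_integral_pos:
  assumes nonneg: "\<And>x. x \<in> pverts G \<Longrightarrow> 0 \<le> w x"
    and mass: "graph_integral G \<mu> (\<lambda>x. (w x)\<^sup>2) = 1"
  shows "0 < graph_integral G \<mu> w"
proof -
  obtain z where "z \<in> pverts G" "w z \<noteq> 0"
    using mass by (cases "\<forall>z \<in> pverts G. w z = 0") (auto simp: graph_integral_def)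
  then show ?thesis
    using nonneg by (intro graph_integral_pos[of w z]) (auto simp: order.strict_iff_order)
qed

lemma unit_mass_bound:
  assumes "graph_integral G \<mu> (\<lambda>x. (v x)\<^sup>2) = 1" and x: "x \<in> pverts G"
  shows "\<bar>v x\<bar> \<le> sqrt (1 / \<mu> x)"
proof -
  have "\<mu> x * (v x)\<^sup>2 \<le> graph_integral G \<mu> (\<lambda>x. (v x)\<^sup>2)"
    unfolding graph_integral_def
    using x measure_pos by (intro member_le_sum) (auto simp: pair_finite_verts less_imp_le)
  then have "(v x)\<^sup>2 \<le> 1 / \<mu> x"
    using assms measure_pos[OF x] by (simp add: field_simps)
  then show ?thesis
    by (metis real_sqrt_abs real_sqrt_le_mono)
qed

text \<open>
  Unit mass bounds the values at each vertex, so Bolzano--Weierstrass applies at the finitely many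
  vertices in turn. Mass is continuous under vertexwise convergence and none is lost in the limit;
  positivity survives only as nonnegativity.
\<close>

lemma unit_mass_convergent_subsequence:
  fixes v :: "nat \<Rightarrow> 'a \<Rightarrow> real"
  assumes mass: "\<And>k. graph_integral G \<mu> (\<lambda>x. (v k x)\<^sup>2) = 1"
    and pos: "\<And>k x. x \<in> pverts G \<Longrightarrow> 0 < v k x"
  obtains r :: "nat \<Rightarrow> nat" and w :: "'a \<Rightarrow> real"
  where "strict_mono r"
    and "\<And>x. x \<in> pverts G \<Longrightarrow> (\<lambda>k. v (r k) x) \<longlonglongrightarrow> w x"
    and "\<And>x. x \<in> pverts G \<Longrightarrow> 0 \<le> w x"
    and "graph_integral G \<mu> (\<lambda>x. (w x)\<^sup>2) = 1"
proof -
  have bdd: "bounded ((\<lambda>f. f x) ` range v)" if "x \<in> pverts G" for x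
    using unit_mass_bound[OF mass that] by (auto simp: bounded_iff)
  have "\<forall>d \<subseteq> pverts G. \<exists>w :: 'a \<Rightarrow> real. \<exists>r. strict_mono r \<and>
      (\<forall>e > 0. \<forall>\<^sub>F k in sequentially. \<forall>x \<in> d. dist (v (r k) x) (w x) < e)"
    by (rule compact_lemma_general[where proj = "\<lambda>f x. f x" and unproj = "\<lambda>f. f"])
      (use bdd pair_finite_verts in auto)
  then obtain w r where r: "strict_mono r"
    and "\<forall>e > 0. \<forall>\<^sub>F k in sequentially. \<forall>x \<in> pverts G. dist (v (r k) x) (w x) < e"
    by blast
  then have lim: "(\<lambda>k. v (r k) x) \<longlonglongrightarrow> w x" if "x \<in> pverts G" for x
    unfolding tendsto_iff using that by (fast elim: eventually_mono)
  have "0 \<le> w x" if "x \<in> pverts G" for x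
    by (rule LIMSEQ_le_const[OF lim[OF that]]) (use pos[OF that] in \<open>auto intro: less_imp_le\<close>)
  moreover have "(\<lambda>k. graph_integral G \<mu> (\<lambda>x. (v (r k) x)\<^sup>2)) \<longlonglongrightarrow> graph_integral G \<mu> (\<lambda>x. (w x)\<^sup>2)"
    by (intro tendsto_graph_integral tendsto_intros lim)
  then have "graph_integral G \<mu> (\<lambda>x. (w x)\<^sup>2) = 1"
    by (simp add: mass LIMSEQ_const_iff)
  ultimately show thesis using that r lim by blast
qed

section \<open>Solutions of unit mass\<close>

text \<open>
  The equation of a normalized solution after rescaling to unit mass; the parameter \<open>c\<close> carries what
  is left of the original mass.
\<close>

definition unit_solution :: "real \<Rightarrow> real \<Rightarrow> real \<Rightarrow> ('a \<Rightarrow> real) \<Rightarrow> bool" where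
  "unit_solution p c l v \<longleftrightarrow>
     (\<forall>x \<in> pverts G. - graph_laplacian G wt \<mu> v x + l * v x = c * v x powr (p - 1)) \<and>
     (\<forall>x \<in> pverts G. 0 < v x) \<and>
     graph_integral G \<mu> (\<lambda>x. (v x)\<^sup>2) = 1"

lemma unit_solution_rescale:
  assumes m: "0 < m" and sol: "normalized_solution G wt \<mu> p m l u"
  shows "unit_solution p (m powr ((p - 2) / 2)) l (\<lambda>x. u x / sqrt m)"
  unfolding unit_solution_def
proof (intro conjI ballI)
  fix x assume x: "x \<in> pverts G"
  have u: "0 < u x" "- graph_laplacian G wt \<mu> u x + l * u x = u x powr (p - 1)"
    using sol x by (auto simp: normalized_solution_def)
  show "0 < u x / sqrt m" using u m by simp
  have "graph_laplacian G wt \<mu> (\<lambda>x. u x / sqrt m) x = graph_laplacian G wt \<mu> u x / sqrt m"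
    by (simp add: graph_laplacian_def diff_divide_distrib[symmetric] sum_divide_distrib[symmetric])
  then have "- graph_laplacian G wt \<mu> (\<lambda>x. u x / sqrt m) x + l * (u x / sqrt m) =
      u x powr (p - 1) / sqrt m"
    by (simp add: u(2)[symmetric] diff_divide_distrib)
  also have "\<dots> = m powr ((p - 2) / 2) * (u x / sqrt m) powr (p - 1)"
  proof -
    have scale: "(u x / sqrt m) powr (p - 1) = u x powr (p - 1) / m powr ((p - 1) / 2)"
      using u m by (simp add: powr_divide powr_half_sqrt[symmetric] powr_powr)
    have exponents: "m powr ((p - 2) / 2) * sqrt m = m powr ((p - 1) / 2)"
      using m by (simp add: powr_half_sqrt[symmetric] powr_add[symmetric] add_divide_distrib[symmetric])
    have "m powr ((p - 2) / 2) * (u x / sqrt m) powr (p - 1) * sqrt m =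
        (m powr ((p - 2) / 2) * sqrt m) * (u x / sqrt m) powr (p - 1)"
      by (simp only: mult_ac)
    also have "\<dots> = u x powr (p - 1)"
      unfolding exponents scale using m by simp
    finally have "m powr ((p - 2) / 2) * (u x / sqrt m) powr (p - 1) * sqrt m = u x powr (p - 1)" .
    then show ?thesis using m by (metis nonzero_mult_div_cancel_right less_irrefl real_sqrt_gt_zero)
  qed
  finally show "- graph_laplacian G wt \<mu> (\<lambda>x. u x / sqrt m) x + l * (u x / sqrt m) =
      m powr ((p - 2) / 2) * (u x / sqrt m) powr (p - 1)" .
next
  have "graph_integral G \<mu> (\<lambda>x. (u x / sqrt m)\<^sup>2) = graph_integral G \<mu> (\<lambda>x. (u x)\<^sup>2) / m"
    using m by (simp add: graph_integral_def power_divide sum_divide_distrib)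
  then show "graph_integral G \<mu> (\<lambda>x. (u x / sqrt m)\<^sup>2) = 1"
    using m sol by (simp add: normalized_solution_def)
qed

text \<open>
  Integrating the equation removes the Laplacian and leaves an explicit formula for the multiplier.
\<close>

lemma multiplier_eq:
  assumes "unit_solution p c l v"
  shows "l = c * (graph_integral G \<mu> (\<lambda>x. v x powr (p - 1)) / graph_integral G \<mu> v)"
proof -
  have pos: "0 < graph_integral G \<mu> v"
    using assms by (intro unit_mass_imp_integral_pos) (auto simp: unit_solution_def less_imp_le)
  have "c * graph_integral G \<mu> (\<lambda>x. v x powr (p - 1)) =
      graph_integral G \<mu> (\<lambda>x. - graph_laplacian G wt \<mu> v x + l * v x)"
    using assms by (simp add: unit_solution_def graph_integral_def sum_distrib_left mult.left_commute)
  also have "\<dots> = l * graph_integral G \<mu> v - graph_integral G \<mu> (graph_laplacian G wt \<mu> v)"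
    by (simp add: graph_integral_def sum_distrib_left sum_subtractf right_diff_distrib mult.left_commute)
  finally show ?thesis
    using pos by (simp add: integral_laplacian field_simps)
qed

section \<open>The two limits\<close>

lemma unit_solutions_powr_tendsto:
  assumes "1 < p"
    and v: "\<And>k. unit_solution p (c k) (l k) (v k)"
    and "(\<lambda>k. v k x) \<longlonglongrightarrow> w x" and "x \<in> pverts G"
  shows "(\<lambda>k. v k x powr (p - 1)) \<longlonglongrightarrow> w x powr (p - 1)"
  using assms by (intro tendsto_powr' tendsto_const) (auto simp: unit_solution_def less_imp_le)

text \<open>
  The quotient is the multiplier divided by the coefficient, by \<open>multiplier_eq\<close>; unit mass of the
  limit keeps the denominator away from \<open>0\<close>.
\<close>

lemma multiplier_quotient_tendsto:
  assumes p: "1 < p"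
    and v: "\<And>k. unit_solution p (c k) (l k) (v k)"
    and lim: "\<And>x. x \<in> pverts G \<Longrightarrow> (\<lambda>k. v k x) \<longlonglongrightarrow> w x"
    and w: "\<And>x. x \<in> pverts G \<Longrightarrow> 0 \<le> w x" "graph_integral G \<mu> (\<lambda>x. (w x)\<^sup>2) = 1"
  shows "(\<lambda>k. graph_integral G \<mu> (\<lambda>x. v k x powr (p - 1)) / graph_integral G \<mu> (v k))
      \<longlonglongrightarrow> graph_integral G \<mu> (\<lambda>x. w x powr (p - 1)) / graph_integral G \<mu> w"
proof -
  have "graph_integral G \<mu> w \<noteq> 0"
    using unit_mass_imp_integral_pos[OF w] by simp
  then show ?thesis
    by (intro tendsto_divide tendsto_graph_integral unit_solutions_powr_tendsto[OF p v] lim)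
qed

text \<open>
  The multiplier vanishes together with the coefficient, which leaves a harmonic limit.
\<close>

lemma unit_solutions_limit_vanishing_coefficient:
  assumes p: "1 < p" and c: "c \<longlonglongrightarrow> 0"
    and v: "\<And>k. unit_solution p (c k) (l k) (v k)"
    and lim: "\<And>x. x \<in> pverts G \<Longrightarrow> (\<lambda>k. v k x) \<longlonglongrightarrow> w x"
    and w: "\<And>x. x \<in> pverts G \<Longrightarrow> 0 \<le> w x" "graph_integral G \<mu> (\<lambda>x. (w x)\<^sup>2) = 1"
    and x: "x \<in> pverts G"
  shows "w x = graph_volume G \<mu> powr (- 1 / 2)"
proof -
  note powr = unit_solutions_powr_tendsto[where w = w, OF p v lim]
    and quot = multiplier_quotient_tendsto[OF p v lim w]
  have l: "l \<longlonglongrightarrow> 0"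
    using tendsto_mult[OF c quot] unfolding multiplier_eq[OF v, symmetric] by simp
  have "graph_laplacian G wt \<mu> w y = 0" if y: "y \<in> pverts G" for y
  proof (rule LIMSEQ_unique[OF tendsto_graph_laplacian[OF lim y]])
    have "(\<lambda>k. l k * v k y - c k * v k y powr (p - 1)) \<longlonglongrightarrow> 0 * w y - 0 * w y powr (p - 1)"
      by (intro tendsto_intros l lim c powr y)
    moreover have "graph_laplacian G wt \<mu> (v k) y = l k * v k y - c k * v k y powr (p - 1)" for k
      using v[of k] y by (auto simp: unit_solution_def algebra_simps)
    ultimately show "(\<lambda>k. graph_laplacian G wt \<mu> (v k) y) \<longlonglongrightarrow> 0" by simp
  qed
  then have const: "w y = w x" if "y \<in> pverts G" for y
    using harmonic_imp_constant that x by blast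
  have "1 = graph_integral G \<mu> (\<lambda>x. (w x)\<^sup>2)" using w(2) by simp
  also have "\<dots> = (w x)\<^sup>2 * graph_volume G \<mu>"
    by (simp add: graph_volume_def graph_integral_def sum_distrib_right const mult.commute)
  finally have eq: "(w x)\<^sup>2 * graph_volume G \<mu> = 1" ..
  have vol: "0 < graph_volume G \<mu>"
    unfolding graph_volume_def using x by (intro graph_integral_pos) auto
  have "w x = sqrt (1 / graph_volume G \<mu>)"
    using eq vol w(1)[OF x] by (intro real_sqrt_unique[symmetric]) (auto simp: field_simps)
  also have "\<dots> = graph_volume G \<mu> powr (- 1 / 2)"
    using vol by (simp add: real_sqrt_divide powr_minus_divide powr_half_sqrt)
  finally show ?thesis .
qed

text \<open>
  The Laplacians stay bounded along a convergent sequence, so after division by the coefficient only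
  the algebraic terms remain.
\<close>

lemma unit_solutions_limit_diverging_coefficient:
  assumes p: "1 < p" and c: "filterlim c at_top sequentially"
    and v: "\<And>k. unit_solution p (c k) (l k) (v k)"
    and lim: "\<And>x. x \<in> pverts G \<Longrightarrow> (\<lambda>k. v k x) \<longlonglongrightarrow> w x"
    and w: "\<And>x. x \<in> pverts G \<Longrightarrow> 0 \<le> w x" "graph_integral G \<mu> (\<lambda>x. (w x)\<^sup>2) = 1"
    and x: "x \<in> pverts G"
  shows "w x powr (p - 1) = graph_Lp_norm G \<mu> p w powr p * w x"
proof -
  note powr = unit_solutions_powr_tendsto[where w = w, OF p v lim]
    and quot = multiplier_quotient_tendsto[OF p v lim w]
  define \<Lambda> where "\<Lambda> = graph_integral G \<mu> (\<lambda>x. w x powr (p - 1)) / graph_integral G \<mu> w"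
  have c_inv: "(\<lambda>k. inverse (c k)) \<longlonglongrightarrow> 0"
    using c by (rule tendsto_inverse_0_at_top)
  have c_pos: "\<forall>\<^sub>F k in sequentially. 0 < c k"
    using c by (simp add: filterlim_at_top_dense)
  have "\<forall>\<^sub>F k in sequentially. l k / c k =
      graph_integral G \<mu> (\<lambda>x. v k x powr (p - 1)) / graph_integral G \<mu> (v k)"
    using c_pos by eventually_elim (subst multiplier_eq[OF v], simp)
  then have \<Lambda>: "(\<lambda>k. l k / c k) \<longlonglongrightarrow> \<Lambda>"
    using quot unfolding \<Lambda>_def by (simp add: tendsto_cong)
  have limit_eq: "w y powr (p - 1) = \<Lambda> * w y" if y: "y \<in> pverts G" for y
  proof (rule LIMSEQ_unique[OF powr[OF y y]])
    have "(\<lambda>k. l k / c k * v k y - graph_laplacian G wt \<mu> (v k) y * inverse (c k))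
        \<longlonglongrightarrow> \<Lambda> * w y - graph_laplacian G wt \<mu> w y * 0"
      by (intro tendsto_intros \<Lambda> c_inv lim tendsto_graph_laplacian y)
    moreover have "\<forall>\<^sub>F k in sequentially. v k y powr (p - 1) =
        l k / c k * v k y - graph_laplacian G wt \<mu> (v k) y * inverse (c k)"
      using c_pos
    proof eventually_elim
      case (elim k)
      have "c k * v k y powr (p - 1) = - graph_laplacian G wt \<mu> (v k) y + l k * v k y"
        using v[of k] y by (simp add: unit_solution_def)
      then show ?case using elim by (simp add: field_simps)
    qed
    ultimately show "(\<lambda>k. v k y powr (p - 1)) \<longlonglongrightarrow> \<Lambda> * w y" by (simp add: tendsto_cong)
  qed
  (* Integrating this identity against unit mass yields the value of \<Lambda>. *)
  have w_powr: "w y powr p = \<Lambda> * (w y)\<^sup>2" if y: "y \<in> pverts G" for y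
  proof -
    have "w y powr p = w y * w y powr (p - 1)"
      using w(1)[OF y] powr_mult_base[of "w y" "p - 1"] by simp
    then show ?thesis by (simp add: limit_eq[OF y] power2_eq_square)
  qed
  have "graph_integral G \<mu> (\<lambda>x. \<bar>w x\<bar> powr p) = \<Lambda> * graph_integral G \<mu> (\<lambda>x. (w x)\<^sup>2)"
    by (simp add: graph_integral_def w(1) w_powr sum_distrib_left mult.left_commute)
  then have "graph_integral G \<mu> (\<lambda>x. \<bar>w x\<bar> powr p) = \<Lambda>" using w(2) by simp
  moreover have "0 \<le> graph_integral G \<mu> (\<lambda>x. \<bar>w x\<bar> powr p)"
    unfolding graph_integral_def using measure_pos by (intro sum_nonneg) (auto simp: less_imp_le)
  ultimately have "graph_Lp_norm G \<mu> p w powr p = \<Lambda>"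
    using p by (simp add: graph_Lp_norm_def powr_powr)
  then show ?thesis using limit_eq[OF x] by simp
qed

end

section \<open>Asymptotics of normalized solutions\<close>

theorem theorem1p2:
  fixes G :: "'a pair_pre_digraph"
    and wt :: "'a \<Rightarrow> 'a \<Rightarrow> real"
    and \<mu> :: "'a \<Rightarrow> real"
    and p :: real
    and u :: "real \<Rightarrow> 'a \<Rightarrow> real"
    and l :: "real \<Rightarrow> real"
  assumes graph: "weighted_finite_graph G wt \<mu>"
    and p: "p > 2"
    and sol: "\<And>m. m > 0 \<Longrightarrow> normalized_solution G wt \<mu> p m (l m) (u m)"
  shows
    "(\<forall>m :: nat \<Rightarrow> real. (\<forall>k. 0 < m k) \<longrightarrow> m \<longlonglongrightarrow> 0 \<longrightarrow>
        (\<exists>(r :: nat \<Rightarrow> nat) (v :: 'a \<Rightarrow> real). strict_mono r \<and>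
          (\<forall>x \<in> pverts G.
             (\<lambda>k. u (m (r k)) x - sqrt (m (r k)) * v x) \<in> o(\<lambda>k. sqrt (m (r k)))) \<and>
          ((\<forall>x \<in> pverts G. v x = graph_volume G \<mu> powr (- 1 / 2)) \<or>
           (\<exists>l0 > 0.
              (\<forall>x \<in> pverts G. - graph_laplacian G wt \<mu> v x = l0 * v x) \<and>
              (\<forall>x \<in> pverts G. 0 < v x) \<and>
              graph_integral G \<mu> (\<lambda>x. (v x)\<^sup>2) = 1)))) \<and>
     (\<forall>m :: nat \<Rightarrow> real. (\<forall>k. 0 < m k) \<longrightarrow> filterlim m at_top sequentially \<longrightarrow>
        (\<exists>(r :: nat \<Rightarrow> nat) (w :: 'a \<Rightarrow> real) (e :: nat \<Rightarrow> 'a \<Rightarrow> real). strict_mono r \<and>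
          (\<forall>k. \<forall>x \<in> pverts G. u (m (r k)) x = sqrt (m (r k)) * (w x + e k x)) \<and>
          (\<forall>x \<in> pverts G. (\<lambda>k. e k x) \<longlonglongrightarrow> 0) \<and>
          (\<forall>x \<in> pverts G.
             w x powr (p - 1) - graph_Lp_norm G \<mu> p w powr p * w x = 0)))"
proof -
  interpret weighted_finite_graph G wt \<mu> by (rule graph)
  have p1: "1 < p" using p by simp
  define c where "c = (\<lambda>m :: real. m powr ((p - 2) / 2))"
  define v where "v = (\<lambda>m x. u m x / sqrt m)"
  have unit: "unit_solution p (c m) (l m) (v m)" if "0 < m" for m
    unfolding c_def v_def using that sol[OF that] by (rule unit_solution_rescale)
  have subseq: "\<exists>r w. strict_mono r \<and>
      (\<forall>x \<in> pverts G. (\<lambda>k. v (m (r k)) x) \<longlonglongrightarrow> w x) \<and>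
      (\<forall>x \<in> pverts G. 0 \<le> w x) \<and> graph_integral G \<mu> (\<lambda>x. (w x)\<^sup>2) = 1"
    if "\<forall>k. 0 < m k" for m :: "nat \<Rightarrow> real"
    by (rule unit_mass_convergent_subsequence[of "\<lambda>k. v (m k)"])
      (use unit that in \<open>auto simp: unit_solution_def\<close>)
  show ?thesis
  proof (intro conjI allI impI)
    fix m :: "nat \<Rightarrow> real"
    assume m: "\<forall>k. 0 < m k" and m_lim: "m \<longlonglongrightarrow> 0"
    obtain r w where r: "strict_mono r"
      and lim: "\<And>x. x \<in> pverts G \<Longrightarrow> (\<lambda>k. v (m (r k)) x) \<longlonglongrightarrow> w x"
      and w: "\<And>x. x \<in> pverts G \<Longrightarrow> 0 \<le> w x" "graph_integral G \<mu> (\<lambda>x. (w x)\<^sup>2) = 1"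
      using subseq[OF m] by blast
    have "(\<lambda>k. m (r k)) \<longlonglongrightarrow> 0"
      using LIMSEQ_subseq_LIMSEQ[OF m_lim r] by (simp add: o_def)
    then have "(\<lambda>k. m (r k) powr ((p - 2) / 2)) \<longlonglongrightarrow> 0 powr ((p - 2) / 2)"
      using p m by (intro tendsto_powr' tendsto_const) (auto simp: less_imp_le)
    then have "(\<lambda>k. c (m (r k))) \<longlonglongrightarrow> 0" by (simp add: c_def)
    from unit_solutions_limit_vanishing_coefficient[OF p1 this unit lim w]
    have const: "w x = graph_volume G \<mu> powr (- 1 / 2)" if "x \<in> pverts G" for x
      using that m by blast
    have "(\<lambda>k. u (m (r k)) x - sqrt (m (r k)) * w x) \<in> o(\<lambda>k. sqrt (m (r k)))"
      if x: "x \<in> pverts G" for x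
    proof (rule smalloI_tendsto)
      have nz: "sqrt (m k) \<noteq> 0" for k using m by (simp add: order.strict_implies_not_eq[symmetric])
      have "(u (m (r k)) x - sqrt (m (r k)) * w x) / sqrt (m (r k)) = v (m (r k)) x - w x" for k
        using nz[of "r k"] by (simp add: v_def diff_divide_distrib)
      moreover have "(\<lambda>k. v (m (r k)) x - w x) \<longlonglongrightarrow> 0"
        using lim[OF x] by (simp add: LIM_zero)
      ultimately show
        "(\<lambda>k. (u (m (r k)) x - sqrt (m (r k)) * w x) / sqrt (m (r k))) \<longlonglongrightarrow> 0" by simp
      show "\<forall>\<^sub>F k in sequentially. sqrt (m (r k)) \<noteq> 0" using nz by simp
    qed
    with r const show "\<exists>(r :: nat \<Rightarrow> nat) (v :: 'a \<Rightarrow> real). strict_mono r \<and>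
          (\<forall>x \<in> pverts G.
             (\<lambda>k. u (m (r k)) x - sqrt (m (r k)) * v x) \<in> o(\<lambda>k. sqrt (m (r k)))) \<and>
          ((\<forall>x \<in> pverts G. v x = graph_volume G \<mu> powr (- 1 / 2)) \<or>
           (\<exists>l0 > 0.
              (\<forall>x \<in> pverts G. - graph_laplacian G wt \<mu> v x = l0 * v x) \<and>
              (\<forall>x \<in> pverts G. 0 < v x) \<and>
              graph_integral G \<mu> (\<lambda>x. (v x)\<^sup>2) = 1))"
      by blast
  next
    fix m :: "nat \<Rightarrow> real"
    assume m: "\<forall>k. 0 < m k" and m_lim: "filterlim m at_top sequentially"
    obtain r w where r: "strict_mono r"
      and lim: "\<And>x. x \<in> pverts G \<Longrightarrow> (\<lambda>k. v (m (r k)) x) \<longlonglongrightarrow> w x"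
      and w: "\<And>x. x \<in> pverts G \<Longrightarrow> 0 \<le> w x" "graph_integral G \<mu> (\<lambda>x. (w x)\<^sup>2) = 1"
      using subseq[OF m] by blast
    have "filterlim (\<lambda>k. m (r k)) at_top sequentially"
      using m_lim filterlim_subseq[OF r] by (rule filterlim_compose)
    moreover have "filterlim c at_top at_top"
      unfolding c_def using p by real_asymp
    ultimately have "filterlim (\<lambda>k. c (m (r k))) at_top sequentially"
      by (rule filterlim_compose[rotated])
    from unit_solutions_limit_diverging_coefficient[OF p1 this unit lim w]
    have eq: "w x powr (p - 1) = graph_Lp_norm G \<mu> p w powr p * w x" if "x \<in> pverts G" for x
      using that m by blast
    define e where "e = (\<lambda>k x. v (m (r k)) x - w x)"
    have "u (m (r k)) x = sqrt (m (r k)) * (w x + e k x)" for k x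
      using m[rule_format, of "r k"] by (simp add: e_def v_def)
    moreover have "(\<lambda>k. e k x) \<longlonglongrightarrow> 0" if "x \<in> pverts G" for x
      unfolding e_def using lim[OF that] by (simp add: LIM_zero)
    ultimately show "\<exists>(r :: nat \<Rightarrow> nat) (w :: 'a \<Rightarrow> real) (e :: nat \<Rightarrow> 'a \<Rightarrow> real). strict_mono r \<and>
          (\<forall>k. \<forall>x \<in> pverts G. u (m (r k)) x = sqrt (m (r k)) * (w x + e k x)) \<and>
          (\<forall>x \<in> pverts G. (\<lambda>k. e k x) \<longlonglongrightarrow> 0) \<and>
          (\<forall>x \<in> pverts G.
             w x powr (p - 1) - graph_Lp_norm G \<mu> p w powr p * w x = 0)"
      using r eq by (intro exI[of _ r] exI[of _ w] exI[of _ e]) auto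
  qed
qed

end
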